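(* Let $\mathbf X^{m-1},\mathbf X^m,\mathbf X^{m+1}\in[\mathcal V^h]^3$ be nodal maps on the closed triangulated reference surface $\widehat S_h$, representing discrete closed surfaces with enclosed volumes $V^{m-1},V^m,V^{m+1}$. Then $$ \begin{aligned} V^{m+1}-V^{m-1}=\int_{\widehat S_h}\frac1{90}\Big(&7\left[-\mathbf X^{m+1}+4\mathbf X^m-3\mathbf X^{m-1}\right]\cdot\mathcal J(\mathbf X^{m-1})\\ &+32\left[2\mathbf X^m-2\mathbf X^{m-1}\right]\cdot\mathcal J\left(\tfrac38\mathbf X^{m-1}+\tfrac34\mathbf X^m-\tfrac18\mathbf X^{m+1}\right)\\ &+12\left[\mathbf X^{m+1}-\mathbf X^{m-1}\right]\cdot\mathcal J(\mathbf X^m)\\ &+32\left[2\mathbf X^{m+1}-2\mathbf X^{m}\right]\cdot\mathcal J\left(-\tfrac18\mathbf X^{m-1}+\tfrac34\mathbf X^m+\tfrac38\mathbf X^{m+1}\right)\\ &+7\left[3\mathbf X^{m+1}-4\mathbf X^m+\mathbf X^{m-1}\right]\cdot\mathcal J(\mathbf X^{m+1})\Big)\,dA_0 . \end{aligned} $$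
   Context: $\widehat S_h=\bigcup_{j=1}^J\widehat\sigma_j$ is a fixed closed triangulated surface in $\mathbb R^3$ with no hanging vertices and nondegenerate triangles $\widehat\sigma_j$ with vertices $\widehat{\mathbf q}_{j1},\widehat{\mathbf q}_{j2},\widehat{\mathbf q}_{j3}$, ordered consistently so that the induced normal is outward. $\mathcal V^h=\{u\in C(\widehat S_h): u|_{\widehat\sigma_j}\in\mathbb P_1,\ j=1,\dots,J\}$. For $\mathbf Z\in[\mathcal V^h]^3$ with $\mathbf z_{jk}=\mathbf Z(\widehat{\mathbf q}_{jk})$, the oriented area vector is $\mathcal J_j(\mathbf Z)=(\mathbf z_{j2}-\mathbf z_{j1})\times(\mathbf z_{j3}-\mathbf z_{j1})$, and $\mathcal J(\mathbf Z)$ is the piecewise constant field on $\widehat S_h$ equal to $\mathcal J_j(\mathbf Z)$ on $\widehat\sigma_j$. The enclosed volume is $V(\mathbf Z)=\frac1{18}\sum_{j=1}^J\sum_{k=1}^3\mathbf z_{jk}\cdot\mathcal J_j(\mathbf Z)$, and $V^k=V(\mathbf X^k)$. The measure $dA_0$ on $\widehat S_h$ is the area measure on each $\widehat\sigma_j$ in reference (unit right triangle) coordinates, i.e. surface measure rescaled so that each $\widehat\sigma_j$ has total mass $\frac12$; thus for $f$ affine on each triangle, $\int_{\widehat S_h}f\,dA_0=\frac16\sum_{j=1}^J\sum_{k=1}^3 f|_{\widehat\sigma_j}(\widehat{\mathbf q}_{jk})$. *)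

theory Defs
  imports "HOL-Analysis.Analysis"
begin

text \<open>
  The mesh consists of triangles \<open>j = 1, \<dots>, J\<close>; \<open>q j k\<close> with \<open>k = 1, 2, 3\<close> is the \<open>k\<close>-th vertex
  of triangle \<open>j\<close>. Values of \<open>q\<close> at other indices are irrelevant. Maps on the surface are total
  functions on \<open>real^3\<close> whose values off the surface are irrelevant.
\<close>

type_synonym mesh = "nat \<Rightarrow> nat \<Rightarrow> real^3"

definition tri :: "mesh \<Rightarrow> nat \<Rightarrow> (real^3) set" where
  "tri q j = convex hull {q j 1, q j 2, q j 3}"

definition mesh_surface :: "nat \<Rightarrow> mesh \<Rightarrow> (real^3) set" where
  "mesh_surface J q = (\<Union>j\<in>{1..J}. tri q j)"

definition closed_surface :: "(real^3) set \<Rightarrow> bool" where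
  "closed_surface S \<longleftrightarrow>
     S \<noteq> {} \<and> compact S \<and>
     (\<forall>x\<in>S. \<exists>U. \<exists>V :: (real^2) set.
        openin (top_of_set S) U \<and> x \<in> U \<and> open V \<and> U homeomorphic V)"

definition oriented_edges :: "mesh \<Rightarrow> nat \<Rightarrow> ((real^3) \<times> (real^3)) set" where
  "oriented_edges q j = {(q j 1, q j 2), (q j 2, q j 3), (q j 3, q j 1)}"

text \<open>Orientations of two triangles sharing an edge agree iff they traverse it in opposite
  directions.\<close>

definition consistently_ordered :: "nat \<Rightarrow> mesh \<Rightarrow> bool" where
  "consistently_ordered J q \<longleftrightarrow>
     (\<forall>i\<in>{1..J}. \<forall>j\<in>{1..J}. i \<noteq> j \<longrightarrow> oriented_edges q i \<inter> oriented_edges q j = {})"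

definition area_vector :: "mesh \<Rightarrow> (real^3 \<Rightarrow> real^3) \<Rightarrow> nat \<Rightarrow> real^3" where
  "area_vector q Z j = cross3 (Z (q j 2) - Z (q j 1)) (Z (q j 3) - Z (q j 1))"

definition outward_ordered :: "nat \<Rightarrow> mesh \<Rightarrow> bool" where
  "outward_ordered J q \<longleftrightarrow>
     (\<forall>j\<in>{1..J}. \<forall>x\<in>rel_interior (tri q j).
        \<forall>\<^sub>F e in at_right 0.
          x + e *\<^sub>R area_vector q (\<lambda>y. y) j \<in> outside (mesh_surface J q) \<and>
          x - e *\<^sub>R area_vector q (\<lambda>y. y) j \<in> inside (mesh_surface J q))"

text \<open>The library predicate \<^const>\<open>triangulation\<close> says that any two triangles meet in a common
  face (possibly empty), which excludes hanging vertices; \<open>inj_on\<close> excludes listing a triangle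
  twice.\<close>

definition closed_triangulated_surface :: "nat \<Rightarrow> mesh \<Rightarrow> bool" where
  "closed_triangulated_surface J q \<longleftrightarrow>
     (\<forall>j\<in>{1..J}. \<not> collinear {q j 1, q j 2, q j 3}) \<and>
     inj_on (tri q) {1..J} \<and>
     triangulation (tri q ` {1..J}) \<and>
     closed_surface (mesh_surface J q) \<and>
     consistently_ordered J q \<and>
     outward_ordered J q"

definition P1_space :: "nat \<Rightarrow> mesh \<Rightarrow> (real^3 \<Rightarrow> real) set" where
  "P1_space J q =
     {u. continuous_on (mesh_surface J q) u \<and>
         (\<forall>j\<in>{1..J}. \<exists>a b. \<forall>x\<in>tri q j. u x = a \<bullet> x + b)}"

definition P1_space3 :: "nat \<Rightarrow> mesh \<Rightarrow> (real^3 \<Rightarrow> real^3) set" where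
  "P1_space3 J q = {Z. \<forall>i. (\<lambda>x. Z x $ i) \<in> P1_space J q}"

text \<open>The piecewise constant field. On shared edges, which are null sets for the measure below,
  the value from the triangle of least index is taken.\<close>

definition area_field :: "nat \<Rightarrow> mesh \<Rightarrow> (real^3 \<Rightarrow> real^3) \<Rightarrow> real^3 \<Rightarrow> real^3" where
  "area_field J q Z x = area_vector q Z (LEAST j. j \<in> {1..J} \<and> x \<in> tri q j)"

definition enclosed_volume :: "nat \<Rightarrow> mesh \<Rightarrow> (real^3 \<Rightarrow> real^3) \<Rightarrow> real" where
  "enclosed_volume J q Z =
     1 / 18 * (\<Sum>j = 1..J. \<Sum>k = 1..3. Z (q j k) \<bullet> area_vector q Z j)"

definition ref_triangle :: "(real \<times> real) set" where
  "ref_triangle = {(s, t). 0 \<le> s \<and> 0 \<le> t \<and> s + t \<le> 1}"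

definition ref_map :: "mesh \<Rightarrow> nat \<Rightarrow> real \<times> real \<Rightarrow> real^3" where
  "ref_map q j = (\<lambda>(s, t). q j 1 + s *\<^sub>R (q j 2 - q j 1) + t *\<^sub>R (q j 3 - q j 1))"

text \<open>The sum over \<open>j\<close> of the images of Lebesgue measure on the reference triangle under the
  affine parametrisations of the triangles, written as one image measure from the disjoint union
  of \<open>J\<close> copies of the reference triangle.\<close>

definition dA0 :: "nat \<Rightarrow> mesh \<Rightarrow> (real^3) measure" where
  "dA0 J q =
     distr (count_space {1..J} \<Otimes>\<^sub>M restrict_space lborel ref_triangle) borel
       (\<lambda>(j, p). ref_map q j p)"

end

theory Submission
  imports Defs
begin

text \<open>
  Write \<open>[a, b, c]\<close> for the scalar triple product. The enclosed volume is one sixth of the sum over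
  the triangles of \<open>[z1, z2, z3]\<close> at the nodal values, so along the quadratic path
  \<open>Z(t)\<close> with \<open>Z(0) = Xprev\<close>, \<open>Z(1/2) = Xcur\<close>, \<open>Z(1) = Xnext\<close> it is a polynomial of degree at most
  six in \<open>t\<close>. The right-hand side is Boole's quadrature rule, with weights
  \<open>7, 32, 12, 32, 7\<close> over \<open>90\<close> at \<open>t = 0, 1/4, 1/2, 3/4, 1\<close>, for the integral of the derivative of this
  polynomial; Boole's rule is exact up to degree five (\<open>boole_triple\<close>).

  What has to be justified is that the derivative of the volume in the direction \<open>W\<close> is the integral of
  \<open>W \<bullet> area_field Z\<close>. On a single triangle this is false: the two differ by three terms, one for each
  oriented edge \<open>(a, b)\<close>, namely \<open>[W a + W b, Z a, Z b]\<close>. These change sign when the edge is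
  reversed, hence cancel as soon as every oriented edge of the mesh occurs once in each direction
  (\<open>sum_edges_eq_0\<close>, \<open>flux_eq\<close>). This is where closedness of the surface enters: an edge belonging to one
  triangle only would have points whose neighbourhood in the surface is a planar half disc,
  against invariance of domain (\<open>mesh_surface_rel_interior\<close>, \<open>opposite_edge\<close>).

  Finally, the integral of a function that is affine on each triangle is one sixth of the sum of its
  vertex values (\<open>integral_piecewise_affine\<close>); the arbitrary choice made by the area field on shared
  edges is invisible because the edges are null sets.
\<close>

section \<open>Every edge is shared by two triangles\<close>

text \<open>
  Near such a point the surface is a piece of the plane of triangle \<open>i\<close>; being also homeomorphic to an
  open set of \<open>real^2\<close>, this piece is open in that plane by invariance of domain.
\<close>

lemma mesh_surface_rel_interior:
  assumes S: "closed_surface (mesh_surface J q)" and i: "i \<in> {1..J}" and x: "x \<in> tri q i"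
    and only: "\<And>j. j \<in> {1..J} \<Longrightarrow> j \<noteq> i \<Longrightarrow> x \<notin> tri q j"
  shows "x \<in> rel_interior (tri q i)"
proof -
  define C where "C = (\<Union>j\<in>{1..J} - {i}. tri q j)"
  have "closed C" unfolding C_def tri_def
    by (intro closed_UN ballI compact_imp_closed compact_convex_hull finite_imp_compact) auto
  have xC: "x \<notin> C" using only by (auto simp: C_def)
  have xS: "x \<in> mesh_surface J q" using i x by (auto simp: mesh_surface_def)
  from S xS obtain U and V :: "(real^2) set" where
    U: "openin (top_of_set (mesh_surface J q)) U" "x \<in> U" and V: "open V" and "U homeomorphic V"
    unfolding closed_surface_def by blast
  then obtain f g where fg: "homeomorphism U V f g" by (auto simp: homeomorphic_def)
  \<comment> \<open>Removing the other triangles keeps a neighbourhood of \<open>x\<close>, as they are closed and miss \<open>x\<close>.\<close>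
  define U' where "U' = U - C"
  define V' where "V' = V \<inter> g -` (- C)"
  have gU: "g ` V' = U'"
    unfolding V'_def U'_def homeomorphism_image2[OF fg, symmetric] by blast
  have U'sub: "U' \<subseteq> tri q i"
    using openin_imp_subset[OF U(1)] by (auto simp: U'_def C_def mesh_surface_def)
  have contg: "continuous_on V g" using fg by (simp add: homeomorphism_def)
  have "open V'" unfolding V'_def
    using continuous_open_preimage[OF contg V, of "- C"] \<open>closed C\<close> by auto
  have "card {q i 1, q i 2, q i 3} \<le> 3"
    by (simp add: card_insert_if)
  then have "aff_dim (tri q i) \<le> 2" unfolding tri_def aff_dim_convex_hull
    using aff_dim_le_card[of "{q i 1, q i 2, q i 3}"] by simp
  moreover have "aff_dim (UNIV :: (real^2) set) = 2" by (simp add: aff_dim_UNIV)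
  ultimately have dim: "aff_dim (affine hull tri q i) \<le> aff_dim (UNIV :: (real^2) set)"
    by (simp add: aff_dim_affine_hull)
  have V'V: "V' \<subseteq> V" by (auto simp: V'_def)
  have contV': "continuous_on V' g" using contg V'V by (rule continuous_on_subset)
  have injV': "inj_on g V'"
    using homeomorphism_apply2[OF fg] V'V by (intro inj_on_inverseI[of _ f]) blast
  have gV': "g \<in> V' \<rightarrow> affine hull tri q i"
    using U'sub gU hull_subset[of "tri q i" affine] by blast
  have "openin (top_of_set UNIV) V'" using \<open>open V'\<close> by simp
  then have "openin (top_of_set (affine hull tri q i)) (g ` V')"
    by (rule invariance_of_domain_affine_sets)
       (rule affine_UNIV affine_affine_hull dim contV' gV' injV')+
  then have "U' \<subseteq> rel_interior (tri q i)"
    unfolding gU using U'sub by (intro rel_interior_maximal)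
  then show ?thesis using U(2) xC by (auto simp: U'_def)
qed

lemma tri_faces:
  assumes "\<not> collinear {q i 1, q i 2, q i 3}" "(a, b) \<in> oriented_edges q i"
  shows "convex hull {a, b} face_of tri q i" "convex hull {a, b} \<noteq> tri q i" "a \<noteq> b"
    "a extreme_point_of tri q i" "b extreme_point_of tri q i"
proof -
  have ind: "\<not> affine_dependent {q i 1, q i 2, q i 3}"
    and ne: "q i 1 \<noteq> q i 2" "q i 1 \<noteq> q i 3" "q i 2 \<noteq> q i 3"
    using assms(1) by (auto simp: collinear_3_eq_affine_dependent)
  have ext: "x extreme_point_of tri q i \<longleftrightarrow> x \<in> {q i 1, q i 2, q i 3}" for x
    using extreme_point_of_convex_hull_affine_independent[OF ind] by (simp add: tri_def)
  have sub: "{a, b} \<subseteq> {q i 1, q i 2, q i 3}"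
    using assms(2) by (auto simp: oriented_edges_def)
  show "convex hull {a, b} face_of tri q i"
    unfolding tri_def using face_of_convex_hull_affine_independent[OF ind] sub by blast
  show "a extreme_point_of tri q i" "b extreme_point_of tri q i" using ext sub by auto
  show "a \<noteq> b" using assms(2) ne by (auto simp: oriented_edges_def)
  show "convex hull {a, b} \<noteq> tri q i"
  proof
    assume "convex hull {a, b} = tri q i"
    then have "{q i 1, q i 2, q i 3} \<subseteq> {a, b}"
      using ext extreme_point_of_convex_hull by (metis subsetI)
    then show False using ne by auto
  qed
qed

text \<open>
  The midpoint of the edge is not in the relative interior of triangle \<open>i\<close>, so some other triangle \<open>j\<close>
  contains it. The intersection of the two triangles is a face of both; as a face of \<open>i\<close> it contains
  the whole edge, and the end points, extreme in \<open>i\<close>, are extreme in this face and therefore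
  vertices of \<open>j\<close>. Consistent ordering leaves only the reversed direction.
\<close>

lemma opposite_edge:
  assumes S: "closed_triangulated_surface J q" and i: "i \<in> {1..J}"
    and e: "(a, b) \<in> oriented_edges q i"
  shows "\<exists>j\<in>{1..J}. (b, a) \<in> oriented_edges q j"
proof -
  have nc: "\<not> collinear {q j 1, q j 2, q j 3}" if "j \<in> {1..J}" for j
    using S that by (auto simp: closed_triangulated_surface_def)
  note F = tri_faces[OF nc[OF i] e]
  define x where "x = midpoint a b"
  have xe: "x \<in> rel_interior (convex hull {a, b})"
    using F(3) unfolding x_def by (simp flip: segment_convex_hull add: rel_interior_closed_segment)
  have "x \<notin> rel_interior (tri q i)"
    using face_of_disjoint_rel_interior[OF F(1,2)] xe rel_interior_subset by blast
  moreover have xi: "x \<in> tri q i"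
    using face_of_imp_subset[OF F(1)] xe rel_interior_subset by blast
  ultimately obtain j where j: "j \<in> {1..J}" "j \<noteq> i" "x \<in> tri q j"
    using mesh_surface_rel_interior[OF _ i xi] S unfolding closed_triangulated_surface_def by metis
  have fi: "tri q i \<inter> tri q j face_of tri q i" and fj: "tri q i \<inter> tri q j face_of tri q j"
    using S i j unfolding closed_triangulated_surface_def triangulation_def
    by (metis (no_types, lifting) image_eqI inf_commute)+
  have sub: "convex hull {a, b} \<subseteq> tri q i \<inter> tri q j"
    using subset_of_face_of[OF fi face_of_imp_subset[OF F(1)]] xe xi j(3) by blast
  have "v \<in> {q j 1, q j 2, q j 3}" if "v \<in> {a, b}" for v
  proof -
    have "v \<in> tri q i \<inter> tri q j" using that sub hull_subset[of "{a, b}" convex] by blast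
    then have "v extreme_point_of tri q j"
      using that F(4,5) extreme_point_of_face[OF fi] extreme_point_of_face[OF fj] by blast
    then show ?thesis unfolding tri_def by (rule extreme_point_of_convex_hull)
  qed
  then have "(a, b) \<in> oriented_edges q j \<or> (b, a) \<in> oriented_edges q j"
    using F(3) by (auto simp: oriented_edges_def)
  moreover have "(a, b) \<notin> oriented_edges q j"
    using S e i j unfolding closed_triangulated_surface_def consistently_ordered_def by blast
  ultimately show ?thesis using j(1) by blast
qed

text \<open>
  Consistent ordering makes the edge sets of the triangles disjoint, and reversal of edges is an involution of
  their union, under which the sum changes sign.
\<close>

lemma sum_edges_eq_0:
  fixes g :: "real^3 \<Rightarrow> real^3 \<Rightarrow> real"
  assumes S: "closed_triangulated_surface J q" and anti: "\<And>a b. g b a = - g a b"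
  shows "(\<Sum>j = 1..J. g (q j 1) (q j 2) + g (q j 2) (q j 3) + g (q j 3) (q j 1)) = 0"
proof -
  define E where "E = (\<Union>j\<in>{1..J}. oriented_edges q j)"
  have fin: "finite (oriented_edges q j)" for j by (simp add: oriented_edges_def)
  have "(\<Sum>j = 1..J. g (q j 1) (q j 2) + g (q j 2) (q j 3) + g (q j 3) (q j 1))
      = (\<Sum>j = 1..J. \<Sum>(a, b)\<in>oriented_edges q j. g a b)"
  proof (rule sum.cong)
    fix j assume "j \<in> {1..J}"
    then have "\<not> collinear {q j 1, q j 2, q j 3}"
      using S by (auto simp: closed_triangulated_surface_def)
    then have "q j 1 \<noteq> q j 2" "q j 1 \<noteq> q j 3" "q j 2 \<noteq> q j 3"
      by (auto simp: collinear_3_eq_affine_dependent)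
    then show "g (q j 1) (q j 2) + g (q j 2) (q j 3) + g (q j 3) (q j 1)
      = (\<Sum>(a, b)\<in>oriented_edges q j. g a b)"
      by (simp add: oriented_edges_def)
  qed simp
  also have "\<dots> = (\<Sum>(a, b)\<in>E. g a b)"
    unfolding E_def using S fin
    by (intro sum.UNION_disjoint[symmetric])
       (auto simp: closed_triangulated_surface_def consistently_ordered_def)
  finally have eq: "(\<Sum>j = 1..J. g (q j 1) (q j 2) + g (q j 2) (q j 3) + g (q j 3) (q j 1))
      = (\<Sum>(a, b)\<in>E. g a b)" .
  have swap: "prod.swap e \<in> E" if "e \<in> E" for e
    using that opposite_edge[OF S] by (cases e) (auto simp: E_def)
  have "(\<Sum>(a, b)\<in>E. g a b) = (\<Sum>(a, b)\<in>E. g b a)"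
    by (rule sum.reindex_bij_witness[of _ prod.swap prod.swap]) (auto dest: swap)
  also have "\<dots> = - (\<Sum>(a, b)\<in>E. g a b)"
    by (subst anti) (simp add: sum_negf case_prod_unfold)
  finally show ?thesis using eq by simp
qed

section \<open>Triple products along quadratic paths\<close>

definition triple :: "real^3 \<Rightarrow> real^3 \<Rightarrow> real^3 \<Rightarrow> real" where
  "triple a b c = a \<bullet> cross3 b c"

lemma triple_simps:
  "triple (a + a') b c = triple a b c + triple a' b c" "triple (a - a') b c = triple a b c - triple a' b c"
  "triple (r *\<^sub>R a) b c = r * triple a b c" "triple (- a) b c = - triple a b c"
  "triple a (b + b') c = triple a b c + triple a b' c" "triple a (b - b') c = triple a b c - triple a b' c"
  "triple a (r *\<^sub>R b) c = r * triple a b c" "triple a (- b) c = - triple a b c"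
  "triple a b (c + c') = triple a b c + triple a b c'" "triple a b (c - c') = triple a b c - triple a b c'"
  "triple a b (r *\<^sub>R c) = r * triple a b c" "triple a b (- c) = - triple a b c"
  by (simp_all add: triple_def cross_add_left cross_add_right cross_mult_left cross_mult_right
      cross_minus_left cross_minus_right left_diff_distrib right_diff_distrib inner_diff_left inner_diff_right
      inner_add_left inner_add_right diff_conv_add_uminus del: add_uminus_conv_diff)

lemma triple_cyclic: "triple b c a = triple a b c" and triple_swap: "triple a c b = - triple a b c"
  by (simp_all add: triple_def cross3_simps)

lemma triple_refl: "triple a b b = 0" "triple a a b = 0" "triple a b a = 0"
  by (simp_all add: triple_def dot_cross_self)

lemma inner_area_vector:
  "w \<bullet> area_vector q Z j =
     triple w (Z (q j 1)) (Z (q j 2)) + triple w (Z (q j 2)) (Z (q j 3)) + triple w (Z (q j 3)) (Z (q j 1))"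
proof -
  have "w \<bullet> area_vector q Z j = triple w (Z (q j 2) - Z (q j 1)) (Z (q j 3) - Z (q j 1))"
    by (simp add: area_vector_def triple_def)
  then show ?thesis
    using triple_swap[of w "Z (q j 1)" "Z (q j 2)"] triple_swap[of w "Z (q j 3)" "Z (q j 1)"]
    by (simp add: triple_simps triple_refl)
qed

text \<open>
  The second polynomial is the derivative of the first, in keeping with the product rule: \<open>u + 2 t v\<close>
  is the velocity of the path \<open>a + t u + t\<^sup>2 v\<close>.
\<close>

lemma triple_quadratic:
  obtains p :: "nat \<Rightarrow> real" where
    "\<And>t. triple (a1 + t *\<^sub>R u1 + t\<^sup>2 *\<^sub>R v1) (a2 + t *\<^sub>R u2 + t\<^sup>2 *\<^sub>R v2) (a3 + t *\<^sub>R u3 + t\<^sup>2 *\<^sub>R v3) =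
       p 0 + p 1 * t + p 2 * t^2 + p 3 * t^3 + p 4 * t^4 + p 5 * t^5 + p 6 * t^6"
    "\<And>t. triple (u1 + (2 * t) *\<^sub>R v1) (a2 + t *\<^sub>R u2 + t\<^sup>2 *\<^sub>R v2) (a3 + t *\<^sub>R u3 + t\<^sup>2 *\<^sub>R v3)
        + triple (a1 + t *\<^sub>R u1 + t\<^sup>2 *\<^sub>R v1) (u2 + (2 * t) *\<^sub>R v2) (a3 + t *\<^sub>R u3 + t\<^sup>2 *\<^sub>R v3)
        + triple (a1 + t *\<^sub>R u1 + t\<^sup>2 *\<^sub>R v1) (a2 + t *\<^sub>R u2 + t\<^sup>2 *\<^sub>R v2) (u3 + (2 * t) *\<^sub>R v3) =
       p 1 + 2 * p 2 * t + 3 * p 3 * t^2 + 4 * p 4 * t^3 + 5 * p 5 * t^4 + 6 * p 6 * t^5"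
proof
  let ?p = "\<lambda>k. [triple a1 a2 a3,
    triple u1 a2 a3 + triple a1 u2 a3 + triple a1 a2 u3,
    triple v1 a2 a3 + triple a1 v2 a3 + triple a1 a2 v3 + triple a1 u2 u3 + triple u1 a2 u3 + triple u1 u2 a3,
    triple u1 u2 u3 + triple a1 u2 v3 + triple a1 v2 u3 + triple u1 a2 v3 + triple v1 a2 u3 + triple u1 v2 a3 + triple v1 u2 a3,
    triple a1 v2 v3 + triple v1 a2 v3 + triple v1 v2 a3 + triple u1 u2 v3 + triple u1 v2 u3 + triple v1 u2 u3,
    triple u1 v2 v3 + triple v1 u2 v3 + triple v1 v2 u3,
    triple v1 v2 v3] ! k"
  fix t :: real
  have nth: "?p 0 = triple a1 a2 a3"
    "?p 1 = triple u1 a2 a3 + triple a1 u2 a3 + triple a1 a2 u3"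
    "?p 2 = triple v1 a2 a3 + triple a1 v2 a3 + triple a1 a2 v3 + triple a1 u2 u3 + triple u1 a2 u3 + triple u1 u2 a3"
    "?p 3 = triple u1 u2 u3 + triple a1 u2 v3 + triple a1 v2 u3 + triple u1 a2 v3 + triple v1 a2 u3 + triple u1 v2 a3 + triple v1 u2 a3"
    "?p 4 = triple a1 v2 v3 + triple v1 a2 v3 + triple v1 v2 a3 + triple u1 u2 v3 + triple u1 v2 u3 + triple v1 u2 u3"
    "?p 5 = triple u1 v2 v3 + triple v1 u2 v3 + triple v1 v2 u3"
    "?p 6 = triple v1 v2 v3"
    by simp_all
  show "triple (a1 + t *\<^sub>R u1 + t\<^sup>2 *\<^sub>R v1) (a2 + t *\<^sub>R u2 + t\<^sup>2 *\<^sub>R v2) (a3 + t *\<^sub>R u3 + t\<^sup>2 *\<^sub>R v3) =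
       ?p 0 + ?p 1 * t + ?p 2 * t^2 + ?p 3 * t^3 + ?p 4 * t^4 + ?p 5 * t^5 + ?p 6 * t^6"
    unfolding nth triple_simps by algebra
  show "triple (u1 + (2 * t) *\<^sub>R v1) (a2 + t *\<^sub>R u2 + t\<^sup>2 *\<^sub>R v2) (a3 + t *\<^sub>R u3 + t\<^sup>2 *\<^sub>R v3)
        + triple (a1 + t *\<^sub>R u1 + t\<^sup>2 *\<^sub>R v1) (u2 + (2 * t) *\<^sub>R v2) (a3 + t *\<^sub>R u3 + t\<^sup>2 *\<^sub>R v3)
        + triple (a1 + t *\<^sub>R u1 + t\<^sup>2 *\<^sub>R v1) (a2 + t *\<^sub>R u2 + t\<^sup>2 *\<^sub>R v2) (u3 + (2 * t) *\<^sub>R v3) =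
       ?p 1 + 2 * ?p 2 * t + 3 * ?p 3 * t^2 + 4 * ?p 4 * t^3 + 5 * ?p 5 * t^4 + 6 * ?p 6 * t^5"
    unfolding nth triple_simps by algebra
qed

text \<open>
  The path \<open>a + t u + t\<^sup>2 v\<close> interpolates \<open>a, b, c\<close> at \<open>t = 0, 1/2, 1\<close>; its positions and velocities at
  the five equidistant nodes are the combinations that occur in the volume formula.
\<close>

lemma quadratic_interpolation_nodes:
  fixes a b c :: "real^3"
  defines "u \<equiv> - c + 4 *\<^sub>R b - 3 *\<^sub>R a" and "v \<equiv> 2 *\<^sub>R a - 4 *\<^sub>R b + 2 *\<^sub>R c"
  shows "a = a + 0 *\<^sub>R u + 0\<^sup>2 *\<^sub>R v"
    and "(3/8) *\<^sub>R a + (3/4) *\<^sub>R b - (1/8) *\<^sub>R c = a + (1/4) *\<^sub>R u + (1/4)\<^sup>2 *\<^sub>R v"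
    and "b = a + (1/2) *\<^sub>R u + (1/2)\<^sup>2 *\<^sub>R v"
    and "- (1/8) *\<^sub>R a + (3/4) *\<^sub>R b + (3/8) *\<^sub>R c = a + (3/4) *\<^sub>R u + (3/4)\<^sup>2 *\<^sub>R v"
    and "c = a + 1 *\<^sub>R u + 1\<^sup>2 *\<^sub>R v"
    and "- c + 4 *\<^sub>R b - 3 *\<^sub>R a = u + (2 * 0) *\<^sub>R v"
    and "2 *\<^sub>R b - 2 *\<^sub>R a = u + (2 * (1/4)) *\<^sub>R v"
    and "c - a = u + (2 * (1/2)) *\<^sub>R v"
    and "2 *\<^sub>R c - 2 *\<^sub>R b = u + (2 * (3/4)) *\<^sub>R v"
    and "3 *\<^sub>R c - 4 *\<^sub>R b + a = u + (2 * 1) *\<^sub>R v"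
  unfolding u_def v_def by (simp_all add: vec_eq_iff field_simps power2_eq_square)

text \<open>
  Boole's rule is exact for the derivative of a polynomial of degree six; here \<open>d\<close> is the derivative of the
  triple product at \<open>z\<close> in the direction \<open>w\<close>.
\<close>

lemma boole_triple:
  fixes a1 a2 a3 b1 b2 b3 c1 c2 c3 :: "real^3"
  defines "d \<equiv> \<lambda>w1 w2 w3 z1 z2 z3. triple w1 z2 z3 + triple z1 w2 z3 + triple z1 z2 w3"
  shows "90 * (triple c1 c2 c3 - triple a1 a2 a3) =
     7 * d (- c1 + 4 *\<^sub>R b1 - 3 *\<^sub>R a1) (- c2 + 4 *\<^sub>R b2 - 3 *\<^sub>R a2) (- c3 + 4 *\<^sub>R b3 - 3 *\<^sub>R a3) a1 a2 a3
   + 32 * d (2 *\<^sub>R b1 - 2 *\<^sub>R a1) (2 *\<^sub>R b2 - 2 *\<^sub>R a2) (2 *\<^sub>R b3 - 2 *\<^sub>R a3)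
       ((3/8) *\<^sub>R a1 + (3/4) *\<^sub>R b1 - (1/8) *\<^sub>R c1) ((3/8) *\<^sub>R a2 + (3/4) *\<^sub>R b2 - (1/8) *\<^sub>R c2)
       ((3/8) *\<^sub>R a3 + (3/4) *\<^sub>R b3 - (1/8) *\<^sub>R c3)
   + 12 * d (c1 - a1) (c2 - a2) (c3 - a3) b1 b2 b3
   + 32 * d (2 *\<^sub>R c1 - 2 *\<^sub>R b1) (2 *\<^sub>R c2 - 2 *\<^sub>R b2) (2 *\<^sub>R c3 - 2 *\<^sub>R b3)
       (- (1/8) *\<^sub>R a1 + (3/4) *\<^sub>R b1 + (3/8) *\<^sub>R c1) (- (1/8) *\<^sub>R a2 + (3/4) *\<^sub>R b2 + (3/8) *\<^sub>R c2)
       (- (1/8) *\<^sub>R a3 + (3/4) *\<^sub>R b3 + (3/8) *\<^sub>R c3)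
   + 7 * d (3 *\<^sub>R c1 - 4 *\<^sub>R b1 + a1) (3 *\<^sub>R c2 - 4 *\<^sub>R b2 + a2) (3 *\<^sub>R c3 - 4 *\<^sub>R b3 + a3) c1 c2 c3"
proof -
  define u v :: "real^3 \<Rightarrow> real^3 \<Rightarrow> real^3 \<Rightarrow> real^3" where
    "u a b c = - c + 4 *\<^sub>R b - 3 *\<^sub>R a" and "v a b c = 2 *\<^sub>R a - 4 *\<^sub>R b + 2 *\<^sub>R c" for a b c
  define u1 u2 u3 v1 v2 v3 where uv: "u1 = u a1 b1 c1" "u2 = u a2 b2 c2" "u3 = u a3 b3 c3"
    "v1 = v a1 b1 c1" "v2 = v a2 b2 c2" "v3 = v a3 b3 c3"
  note nodes = quadratic_interpolation_nodes[folded u_def v_def]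
  note nodes1 = nodes[where a = a1 and b = b1 and c = c1, folded uv]
  note nodes2 = nodes[where a = a2 and b = b2 and c = c2, folded uv]
  note nodes3 = nodes[where a = a3 and b = b3 and c = c3, folded uv]
  obtain p :: "nat \<Rightarrow> real" where
    p: "\<And>t. triple (a1 + t *\<^sub>R u1 + t\<^sup>2 *\<^sub>R v1) (a2 + t *\<^sub>R u2 + t\<^sup>2 *\<^sub>R v2) (a3 + t *\<^sub>R u3 + t\<^sup>2 *\<^sub>R v3) =
       p 0 + p 1 * t + p 2 * t^2 + p 3 * t^3 + p 4 * t^4 + p 5 * t^5 + p 6 * t^6"
    and p': "\<And>t. d (u1 + (2 * t) *\<^sub>R v1) (u2 + (2 * t) *\<^sub>R v2) (u3 + (2 * t) *\<^sub>R v3)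
        (a1 + t *\<^sub>R u1 + t\<^sup>2 *\<^sub>R v1) (a2 + t *\<^sub>R u2 + t\<^sup>2 *\<^sub>R v2) (a3 + t *\<^sub>R u3 + t\<^sup>2 *\<^sub>R v3) =
       p 1 + 2 * p 2 * t + 3 * p 3 * t^2 + 4 * p 4 * t^3 + 5 * p 5 * t^4 + 6 * p 6 * t^5"
    unfolding d_def by (rule triple_quadratic[of a1 u1 v1 a2 u2 v2 a3 u3 v3]) (rule that[unfolded d_def])
  show ?thesis
    using p[of 0] p[of 1] p'[of 0] p'[of "1/4"] p'[of "1/2"] p'[of "3/4"] p'[of 1]
    unfolding nodes1(1-5)[symmetric] nodes2(1-5)[symmetric] nodes3(1-5)[symmetric]
      nodes1(6-10)[symmetric] nodes2(6-10)[symmetric] nodes3(6-10)[symmetric]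
    by (simp add: power_divide uv u_def)
qed

section \<open>First variation of the enclosed volume\<close>

text \<open>
  For nodal maps, six times the integral of \<open>W \<bullet> area_field Z\<close> over the surface.
\<close>

definition flux :: "nat \<Rightarrow> mesh \<Rightarrow> (real^3 \<Rightarrow> real^3) \<Rightarrow> (real^3 \<Rightarrow> real^3) \<Rightarrow> real" where
  "flux J q W Z = (\<Sum>j = 1..J. (W (q j 1) + W (q j 2) + W (q j 3)) \<bullet> area_vector q Z j)"

text \<open>
  The right-hand side is six times the derivative of the enclosed volume at \<open>Z\<close> in the direction \<open>W\<close>.
  Triangle by triangle the two sides differ by the antisymmetric edge terms \<open>g\<close>, which cancel globally.
\<close>

lemma flux_eq:
  assumes "closed_triangulated_surface J q"
  shows "flux J q W Z = (\<Sum>j = 1..J. triple (W (q j 1)) (Z (q j 2)) (Z (q j 3))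
     + triple (Z (q j 1)) (W (q j 2)) (Z (q j 3)) + triple (Z (q j 1)) (Z (q j 2)) (W (q j 3)))"
proof -
  define g where "g a b = triple (W a + W b) (Z a) (Z b)" for a b
  have loc: "(W (q j 1) + W (q j 2) + W (q j 3)) \<bullet> area_vector q Z j =
      (triple (W (q j 1)) (Z (q j 2)) (Z (q j 3)) + triple (Z (q j 1)) (W (q j 2)) (Z (q j 3))
        + triple (Z (q j 1)) (Z (q j 2)) (W (q j 3)))
      + (g (q j 1) (q j 2) + g (q j 2) (q j 3) + g (q j 3) (q j 1))" for j
    using triple_cyclic[of "Z (q j 3)" "Z (q j 1)" "W (q j 2)"]
      triple_cyclic[of "W (q j 2)" "Z (q j 3)" "Z (q j 1)"]
      triple_cyclic[of "Z (q j 1)" "Z (q j 2)" "W (q j 3)"]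
    unfolding inner_area_vector g_def triple_simps by linarith
  have "g b a = - g a b" for a b
    unfolding g_def by (subst triple_swap) (simp add: add.commute)
  from sum_edges_eq_0[OF assms this] show ?thesis
    unfolding flux_def loc by (simp add: sum.distrib)
qed

lemma enclosed_volume_eq:
  "enclosed_volume J q Z = 1 / 6 * (\<Sum>j = 1..J. triple (Z (q j 1)) (Z (q j 2)) (Z (q j 3)))"
proof -
  have loc: "(\<Sum>k = 1..3. Z (q j k) \<bullet> area_vector q Z j) =
      3 * triple (Z (q j 1)) (Z (q j 2)) (Z (q j 3))" for j
  proof -
    have "{1..3} = {1, 2, 3::nat}" by auto
    then show ?thesis
      using triple_cyclic[of "Z (q j 3)" "Z (q j 1)" "Z (q j 2)"]
        triple_cyclic[of "Z (q j 1)" "Z (q j 2)" "Z (q j 3)"]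
      by (simp add: inner_area_vector triple_refl)
  qed
  show ?thesis unfolding enclosed_volume_def loc by (simp flip: sum_distrib_left)
qed

section \<open>Integration of piecewise affine functions\<close>

lemma compact_tri: "compact (tri q j)"
  unfolding tri_def by (intro compact_convex_hull finite_imp_compact) auto

lemma compact_ref_triangle: "compact ref_triangle"
proof -
  have "ref_triangle = ({0..1} \<times> {0..1}) \<inter> {p. fst p + snd p \<le> 1}"
    by (auto simp: ref_triangle_def)
  moreover have "closed {p :: real \<times> real. fst p + snd p \<le> 1}"
    by (intro closed_Collect_le continuous_intros)
  ultimately show ?thesis by (metis compact_Icc compact_Int_closed compact_Times)
qed

lemma ref_triangle_sets [measurable]: "ref_triangle \<in> sets borel"
  using compact_ref_triangle by (simp add: borel_compact)

lemma has_bochner_integral_ref_triangle_affine: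
  fixes a b c :: real
  shows "has_bochner_integral (restrict_space lborel ref_triangle)
    (\<lambda>(s, t). c + s * a + t * b) (c / 2 + a / 6 + b / 6)"
proof -
  define f where "f = (\<lambda>p :: real \<times> real. c + fst p * a + snd p * b)"
  define g where "g = (\<lambda>p. indicator ref_triangle p *\<^sub>R f p)"
  have int: "integrable lborel g"
    unfolding g_def f_def by (intro borel_integrable_compact compact_ref_triangle continuous_intros)
  have inner: "(LINT t|lborel. g (s, t)) =
      ((c + s * a) * (1 - s) + b / 2 * (1 - s)\<^sup>2) * indicator {0..1} s" (is "_ = ?G s * _") for s
  proof (cases "s \<in> {0..1}")
    case True
    have "(LINT t|lborel. g (s, t)) = (LINT t|lborel. (c + s * a + t * b) * indicator {0..1 - s} t)"
      using True by (intro Bochner_Integration.integral_cong) 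
        (auto simp: g_def f_def ref_triangle_def indicator_def)
    also have "\<dots> = (c + s * a) * (1 - s) + b / 2 * (1 - s)\<^sup>2
        - ((c + s * a) * 0 + b / 2 * 0\<^sup>2)"
      using True 
      by (intro integral_FTC_Icc_real[where F = "\<lambda>t. (c + s * a) * t + b / 2 * t\<^sup>2"])
         (auto intro!: derivative_eq_intros continuous_intros)
    finally show ?thesis using True by simp
  next
    case False
    then have "(\<lambda>t. g (s, t)) = (\<lambda>t. 0)"
      by (auto simp: g_def ref_triangle_def indicator_def)
    then show ?thesis using False by simp
  qed
  have "(LINT p|lborel. g p) = (LINT s|lborel. LINT t|lborel. g (s, t))"
    using lborel_pair.integral_fst'[of g] int by (simp add: lborel_prod)
  also have "\<dots> = (LINT s|lborel. ?G s * indicator {0..1} s)" by (simp only: inner)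
  also have "\<dots> = (c * 1 + (a - c) * 1\<^sup>2 / 2 - a * 1^3 / 3 + b / 2 * (1 - 1\<^sup>2 + 1^3 / 3))
      - (c * 0 + (a - c) * 0\<^sup>2 / 2 - a * 0^3 / 3 + b / 2 * (0 - 0\<^sup>2 + 0^3 / 3))"
    by (intro integral_FTC_Icc_real[where F = 
          "\<lambda>s. c * s + (a - c) * s\<^sup>2 / 2 - a * s^3 / 3 + b / 2 * (s - s\<^sup>2 + s^3 / 3)"])
       (auto intro!: derivative_eq_intros continuous_intros simp: power2_eq_square field_simps)
  also have "\<dots> = c / 2 + a / 6 + b / 6" by (simp add: field_simps)
  finally show ?thesis
    using int unfolding g_def f_def
    by (subst has_bochner_integral_restrict_space)
       (auto simp: has_bochner_integral_iff case_prod_unfold)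
qed

lemma AE_ref_triangle_interior:
  "AE (s, t) in lborel. (s :: real) \<noteq> 0 \<and> (t :: real) \<noteq> 0 \<and> s + t \<noteq> 1"
proof -
  have "AE p in lborel. v \<bullet> p \<noteq> r" if "v \<noteq> 0" for v :: "real \<times> real" and r
  proof -
    have "{p. v \<bullet> p = r} \<in> null_sets lebesgue"
      using negligible_hyperplane[of v r] that by (simp add: negligible_iff_null_sets)
    then have "AE p in lebesgue. p \<notin> {p. v \<bullet> p = r}" by (rule AE_not_in)
    then show ?thesis by (simp add: AE_completion_iff)
  qed
  from this[of "(1, 0)" 0] this[of "(0, 1)" 0] this[of "(1, 1)" 1]
  show ?thesis by (auto simp: zero_prod_def)
qed

lemma ref_map_in_tri:
  assumes "p \<in> ref_triangle"
  shows "ref_map q j p \<in> tri q j"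
  using assms by (cases p) (force simp: ref_triangle_def ref_map_def tri_def convex_hull_3_alt)

lemma ref_map_rel_interior:
  assumes nc: "\<not> collinear {q j 1, q j 2, q j 3}" and "0 < s" "0 < t" "s + t < 1"
  shows "ref_map q j (s, t) \<in> rel_interior (tri q j)"
proof -
  have ne: "q j 1 \<noteq> q j 2" "q j 1 \<noteq> q j 3" "q j 2 \<noteq> q j 3"
    using nc by (auto simp: collinear_3_eq_affine_dependent)
  define u where "u = (\<lambda>x. if x = q j 1 then 1 - s - t else if x = q j 2 then s else t)"
  have "(\<Sum>x\<in>{q j 1, q j 2, q j 3}. u x) = 1"
    using ne by (simp add: u_def)
  moreover have "(\<Sum>x\<in>{q j 1, q j 2, q j 3}. u x *\<^sub>R x) = ref_map q j (s, t)"
    using ne by (simp add: u_def ref_map_def algebra_simps)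
  moreover have "\<forall>x\<in>{q j 1, q j 2, q j 3}. 0 < u x"
    using assms by (simp add: u_def)
  ultimately show ?thesis unfolding tri_def
    by (intro subsetD[OF explicit_subset_rel_interior_convex_hull_minimal]) blast+
qed

text \<open>
  The intersection is a face of both triangles. Containing a relative interior point of triangle \<open>i\<close>, it
  is the whole of \<open>i\<close>, hence a face of triangle \<open>j\<close> of full dimension, hence the whole of \<open>j\<close>.
\<close>

lemma rel_interior_tri_disjoint:
  assumes S: "closed_triangulated_surface J q" and ij: "i \<in> {1..J}" "j \<in> {1..J}"
    and x: "x \<in> rel_interior (tri q i)" "x \<in> tri q j"
  shows "i = j"
proof -
  have fi: "tri q i \<inter> tri q j face_of tri q i" and fj: "tri q i \<inter> tri q j face_of tri q j"
    using S ij unfolding closed_triangulated_surface_def triangulation_def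
    by (metis (no_types, lifting) image_eqI inf_commute)+
  have "tri q i \<subseteq> tri q i \<inter> tri q j"
    using subset_of_face_of[OF fi order_refl] x rel_interior_subset by blast
  then have eq: "tri q i \<inter> tri q j = tri q i" by blast
  have dim: "aff_dim (tri q k) = 2" if "k \<in> {1..J}" for k
  proof -
    have "\<not> collinear {q k 1, q k 2, q k 3}"
      using S that by (auto simp: closed_triangulated_surface_def)
    then have "\<not> affine_dependent {q k 1, q k 2, q k 3}" "card {q k 1, q k 2, q k 3} = 3"
      by (auto simp: collinear_3_eq_affine_dependent)
    then show ?thesis unfolding tri_def aff_dim_convex_hull
      using aff_dim_affine_independent[of "{q k 1, q k 2, q k 3}"] by linarith
  qed
  have "convex (tri q j)" by (simp add: tri_def)
  then have "tri q i = tri q j"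
    using face_of_aff_dim_lt[of "tri q j" "tri q i"] fj eq dim ij by force
  then show ?thesis
    using S ij unfolding closed_triangulated_surface_def by (auto dest: inj_onD)
qed

text \<open>
  The index on which \<^const>\<open>area_field\<close> relies, so that the integrands of interest have the form
  \<open>h (tri_index J q x) x\<close>.
\<close>

definition tri_index :: "nat \<Rightarrow> mesh \<Rightarrow> real^3 \<Rightarrow> nat" where
  "tri_index J q x = (LEAST j. j \<in> {1..J} \<and> x \<in> tri q j)"

lemma tri_index:
  assumes "x \<in> mesh_surface J q"
  shows "tri_index J q x \<in> {1..J}" "x \<in> tri q (tri_index J q x)"
proof -
  from assms have "\<exists>j. j \<in> {1..J} \<and> x \<in> tri q j" by (auto simp: mesh_surface_def)
  from LeastI_ex[OF this]
  show "tri_index J q x \<in> {1..J}" "x \<in> tri q (tri_index J q x)" unfolding tri_index_def by auto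
qed

lemma integral_dA0:
  fixes f :: "real^3 \<Rightarrow> real"
  assumes f [measurable]: "f \<in> borel_measurable borel"
    and int: "\<And>j. j \<in> {1..J} \<Longrightarrow> integrable (restrict_space lborel ref_triangle) (\<lambda>p. f (ref_map q j p))"
  shows "integral\<^sup>L (dA0 J q) f =
    (\<Sum>j = 1..J. LINT p|restrict_space lborel ref_triangle. f (ref_map q j p))"
proof -
  let ?R = "restrict_space lborel ref_triangle" and ?C = "count_space {1..J}"
  have R: "sigma_finite_measure ?R"
    by (intro sigma_finite_measure_restrict_space lborel.sigma_finite_measure_axioms) simp
  interpret P: pair_sigma_finite ?C ?R
    using R by (simp add: pair_sigma_finite_def sigma_finite_measure_count_space_finite)
  have "ref_map q j \<in> borel_measurable borel" for j
    unfolding ref_map_def case_prod_unfold by (intro borel_measurable_continuous_onI continuous_intros)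
  then have "ref_map q j \<in> borel_measurable ?R" for j
    by (intro measurable_restrict_space1) simp
  then have m: "(\<lambda>(j, p). ref_map q j p) \<in> borel_measurable (?C \<Otimes>\<^sub>M ?R)"
    by (intro measurable_pair_measure_countable1) auto
  have int': "integrable (?C \<Otimes>\<^sub>M ?R) (\<lambda>z. f (case z of (j, p) \<Rightarrow> ref_map q j p))"
    using int by (intro P.Fubini_integrable measurable_compose[OF m] f)
      (auto intro!: integrable_count_space AE_I2)
  have "integral\<^sup>L (dA0 J q) f = (LINT z|(?C \<Otimes>\<^sub>M ?R). f (case z of (j, p) \<Rightarrow> ref_map q j p))"
    unfolding dA0_def by (rule integral_distr[OF m f])
  also have "\<dots> = (LINT j|?C. LINT p|?R. f (ref_map q j p))"
    using P.integral_fst'[OF int'] by simp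
  finally show ?thesis by (simp add: lebesgue_integral_count_space_finite)
qed

text \<open>
  The points with index \<open>j\<close> form the closed triangle \<open>j\<close> minus the finitely many closed triangles listed
  before it.
\<close>

lemma borel_measurable_piecewise:
  fixes h :: "nat \<Rightarrow> real^3 \<Rightarrow> real"
  assumes cont: "\<And>j. j \<in> {1..J} \<Longrightarrow> continuous_on (tri q j) (h j)"
  shows "(\<lambda>x. indicator (mesh_surface J q) x *\<^sub>R h (tri_index J q x) x) \<in> borel_measurable borel"
proof -
  define D where "D j = (\<Union>i\<in>{1..<j}. tri q i)" for j
  have eq: "indicator (mesh_surface J q) x *\<^sub>R h (tri_index J q x) x =
      (\<Sum>j = 1..J. indicator (- D j) x *\<^sub>R (indicator (tri q j) x *\<^sub>R h j x))" for x
  proof (cases "x \<in> mesh_surface J q")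
    case True
    have "indicator (- D j) x *\<^sub>R (indicator (tri q j) x *\<^sub>R h j x) =
        (if j = tri_index J q x then h j x else 0)" if "j \<in> {1..J}" for j
    proof (cases "j = tri_index J q x")
      case T: True
      have "x \<notin> tri q i" if "i \<in> {1..<j}" for i
        using not_less_Least[of i "\<lambda>j. j \<in> {1..J} \<and> x \<in> tri q j"] that \<open>j \<in> {1..J}\<close> T
        by (auto simp: tri_index_def)
      then show ?thesis using T tri_index(2)[OF True] by (auto simp: D_def)
    next
      case F: False
      have "x \<in> D j" if "x \<in> tri q j"
      proof -
        have "tri_index J q x \<le> j"
          unfolding tri_index_def using that \<open>j \<in> {1..J}\<close> by (intro Least_le) auto
        then show ?thesis using F tri_index[OF True] by (auto simp: D_def intro!: bexI[of _ "tri_index J q x"])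
      qed
      then show ?thesis using F by (auto simp: indicator_def)
    qed
    then have "(\<Sum>j = 1..J. indicator (- D j) x *\<^sub>R (indicator (tri q j) x *\<^sub>R h j x)) =
        (\<Sum>j = 1..J. if j = tri_index J q x then h j x else 0)"
      by (intro sum.cong refl)
    then show ?thesis using tri_index(1)[OF True] True by simp
  next
    case False
    then show ?thesis by (auto simp: mesh_surface_def indicator_def intro!: sum.neutral[symmetric])
  qed
  have closed: "closed (tri q j)" for j using compact_tri by (rule compact_imp_closed)
  have [measurable]: "(\<lambda>x. indicator (tri q j) x *\<^sub>R h j x) \<in> borel_measurable borel"
    if "j \<in> {1..J}" for j
    using closed cont that by (intro borel_measurable_continuous_on_indicator) auto
  have [measurable]: "D j \<in> sets borel" for j
    unfolding D_def using closed by (intro sets.finite_UN) auto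
  show ?thesis unfolding eq by measurable
qed

text \<open>
  Away from the boundary of the reference triangle the index chosen on triangle \<open>j\<close> is \<open>j\<close> itself, so almost
  everywhere the pulled back integrand is an affine function of the reference coordinates.
\<close>

lemma integral_piecewise_affine:
  fixes h :: "nat \<Rightarrow> real^3 \<Rightarrow> real"
  assumes S: "closed_triangulated_surface J q"
    and cont: "\<And>j. j \<in> {1..J} \<Longrightarrow> continuous_on (tri q j) (h j)"
    and aff: "\<And>j s t. j \<in> {1..J} \<Longrightarrow> (s, t) \<in> ref_triangle \<Longrightarrow>
      h j (ref_map q j (s, t)) =
        h j (q j 1) + s * (h j (q j 2) - h j (q j 1)) + t * (h j (q j 3) - h j (q j 1))"
  shows "(LINT x:mesh_surface J q|dA0 J q. h (tri_index J q x) x) =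
    1 / 6 * (\<Sum>j = 1..J. h j (q j 1) + h j (q j 2) + h j (q j 3))"
proof -
  let ?R = "restrict_space lborel ref_triangle"
  define F where "F = (\<lambda>x. indicator (mesh_surface J q) x *\<^sub>R h (tri_index J q x) x)"
  have F [measurable]: "F \<in> borel_measurable borel"
    unfolding F_def using cont by (rule borel_measurable_piecewise)
  have loc: "has_bochner_integral ?R (\<lambda>p. F (ref_map q j p))
      (1 / 6 * (h j (q j 1) + h j (q j 2) + h j (q j 3)))" if j: "j \<in> {1..J}" for j
  proof -
    let ?G = "\<lambda>(s, t). h j (q j 1) + s * (h j (q j 2) - h j (q j 1)) + t * (h j (q j 3) - h j (q j 1))"
    have nc: "\<not> collinear {q j 1, q j 2, q j 3}"
      using S j by (auto simp: closed_triangulated_surface_def)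
    have pt: "F (ref_map q j (s, t)) = ?G (s, t)"
      if st: "(s, t) \<in> ref_triangle" "s \<noteq> 0" "t \<noteq> 0" "s + t \<noteq> 1" for s t
    proof -
      let ?x = "ref_map q j (s, t)"
      have ri: "?x \<in> rel_interior (tri q j)"
        using st by (intro ref_map_rel_interior nc) (auto simp: ref_triangle_def)
      have xS: "?x \<in> mesh_surface J q"
        using j ref_map_in_tri[OF st(1), of q j] unfolding mesh_surface_def by blast
      have "j = tri_index J q ?x"
        using rel_interior_tri_disjoint[OF S j _ ri] tri_index[OF xS] by blast
      then show ?thesis using xS aff[OF j st(1)] by (simp add: F_def)
    qed
    have AE: "AE p in ?R. F (ref_map q j p) = ?G p"
      using AE_ref_triangle_interior
      by (subst AE_restrict_space_iff) (auto elim!: eventually_mono simp: pt)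
    have "ref_map q j \<in> borel_measurable borel"
      unfolding ref_map_def case_prod_unfold
      by (intro borel_measurable_continuous_onI continuous_intros)
    then have m: "ref_map q j \<in> borel_measurable ?R"
      by (intro measurable_restrict_space1) simp
    have "h j (q j 1) / 2 + (h j (q j 2) - h j (q j 1)) / 6 + (h j (q j 3) - h j (q j 1)) / 6 =
        1 / 6 * (h j (q j 1) + h j (q j 2) + h j (q j 3))"
      by (simp add: field_simps)
    then have G: "has_bochner_integral ?R ?G (1 / 6 * (h j (q j 1) + h j (q j 2) + h j (q j 3)))"
      using has_bochner_integral_ref_triangle_affine
        [of "h j (q j 1)" "h j (q j 2) - h j (q j 1)" "h j (q j 3) - h j (q j 1)"]
      by (simp only:)
    have "?G \<in> borel_measurable ?R" using G by (auto simp: has_bochner_integral_iff)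
    then show ?thesis using G AE measurable_compose[OF m F]
      by (subst has_bochner_integral_cong_AE[where g = ?G]) auto
  qed
  have "(LINT x:mesh_surface J q|dA0 J q. h (tri_index J q x) x) = integral\<^sup>L (dA0 J q) F"
    by (simp add: set_lebesgue_integral_def F_def)
  also have "\<dots> = (\<Sum>j = 1..J. LINT p|?R. F (ref_map q j p))"
    using loc by (intro integral_dA0 F) (auto simp: has_bochner_integral_iff)
  also have "\<dots> = (\<Sum>j = 1..J. 1 / 6 * (h j (q j 1) + h j (q j 2) + h j (q j 3)))"
    using loc by (intro sum.cong) (auto simp: has_bochner_integral_iff)
  finally show ?thesis by (simp add: sum_distrib_left)
qed

section \<open>Nodal maps\<close>

lemma P1_affine:
  assumes "Z \<in> P1_space3 J q" "j \<in> {1..J}" "(s, t) \<in> ref_triangle"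
  shows "Z (ref_map q j (s, t)) = Z (q j 1) + s *\<^sub>R (Z (q j 2) - Z (q j 1)) + t *\<^sub>R (Z (q j 3) - Z (q j 1))"
proof -
  have v: "q j 1 \<in> tri q j" "q j 2 \<in> tri q j" "q j 3 \<in> tri q j"
    unfolding tri_def by (auto intro: hull_inc)
  have "Z (ref_map q j (s, t)) $ i = (Z (q j 1) + s *\<^sub>R (Z (q j 2) - Z (q j 1)) + t *\<^sub>R (Z (q j 3) - Z (q j 1))) $ i" for i
  proof -
    obtain a b where ab: "\<And>x. x \<in> tri q j \<Longrightarrow> Z x $ i = a \<bullet> x + b"
      using assms(1,2) unfolding P1_space3_def P1_space_def by blast
    show ?thesis
      using ab[OF v(1)] ab[OF v(2)] ab[OF v(3)] ab[OF ref_map_in_tri[OF assms(3)]]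
      by (simp add: ref_map_def inner_add_right inner_diff_right)
  qed
  then show ?thesis by (simp add: vec_eq_iff)
qed

lemma P1_continuous:
  assumes "Z \<in> P1_space3 J q"
  shows "continuous_on (mesh_surface J q) Z"
proof -
  have "continuous_on (mesh_surface J q) (\<lambda>x. \<chi> i. Z x $ i)"
    using assms by (intro continuous_on_vec_lambda) (auto simp: P1_space3_def P1_space_def)
  then show ?thesis by simp
qed

lemma P1_lincomb:
  assumes "X \<in> P1_space3 J q" "Y \<in> P1_space3 J q" "Z \<in> P1_space3 J q"
  shows "(\<lambda>x. a *\<^sub>R X x + b *\<^sub>R Y x + c *\<^sub>R Z x) \<in> P1_space3 J q"
proof -
  have "\<exists>v r. \<forall>x\<in>tri q j. a * X x $ i + b * Y x $ i + c * Z x $ i = v \<bullet> x + r"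
    if j: "j \<in> {1..J}" for i j
  proof -
    obtain u1 r1 u2 r2 u3 r3 where
      "\<forall>x\<in>tri q j. X x $ i = u1 \<bullet> x + r1" "\<forall>x\<in>tri q j. Y x $ i = u2 \<bullet> x + r2"
      "\<forall>x\<in>tri q j. Z x $ i = u3 \<bullet> x + r3"
      using assms j unfolding P1_space3_def P1_space_def by blast
    then show ?thesis
      by (intro exI[of _ "a *\<^sub>R u1 + b *\<^sub>R u2 + c *\<^sub>R u3"] exI[of _ "a * r1 + b * r2 + c * r3"])
         (simp add: inner_add_left algebra_simps)
  qed
  moreover have "continuous_on (mesh_surface J q) (\<lambda>x. a * X x $ i + b * Y x $ i + c * Z x $ i)" for i
    using assms by (intro continuous_intros P1_continuous)
  ultimately show ?thesis unfolding P1_space3_def P1_space_def by simp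
qed

section \<open>The volume identity\<close>

theorem mainTheorem4:
  fixes J :: nat and q :: mesh
    and Xprev Xcur Xnext :: "real^3 \<Rightarrow> real^3"
  assumes "closed_triangulated_surface J q"
    and "Xprev \<in> P1_space3 J q"
    and "Xcur \<in> P1_space3 J q"
    and "Xnext \<in> P1_space3 J q"
  shows "enclosed_volume J q Xnext - enclosed_volume J q Xprev =
    (LINT x:mesh_surface J q|dA0 J q. 1 / 90 *
      (7 * ((- Xnext x + 4 *\<^sub>R Xcur x - 3 *\<^sub>R Xprev x) \<bullet> area_field J q Xprev x)
       + 32 * ((2 *\<^sub>R Xcur x - 2 *\<^sub>R Xprev x) \<bullet>
           area_field J q
             (\<lambda>y. (3/8) *\<^sub>R Xprev y + (3/4) *\<^sub>R Xcur y - (1/8) *\<^sub>R Xnext y) x)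
       + 12 * ((Xnext x - Xprev x) \<bullet> area_field J q Xcur x)
       + 32 * ((2 *\<^sub>R Xnext x - 2 *\<^sub>R Xcur x) \<bullet>
           area_field J q
             (\<lambda>y. - (1/8) *\<^sub>R Xprev y + (3/4) *\<^sub>R Xcur y + (3/8) *\<^sub>R Xnext y) x)
       + 7 * ((3 *\<^sub>R Xnext x - 4 *\<^sub>R Xcur x + Xprev x) \<bullet> area_field J q Xnext x)))"
proof -
  \<comment> \<open>The velocities \<open>W\<close> and positions \<open>Z\<close> of the interpolating path at the five nodes.\<close>
  define W0 where "W0 = (\<lambda>x. - Xnext x + 4 *\<^sub>R Xcur x - 3 *\<^sub>R Xprev x)"
  define W1 where "W1 = (\<lambda>x. 2 *\<^sub>R Xcur x - 2 *\<^sub>R Xprev x)"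
  define W2 where "W2 = (\<lambda>x. Xnext x - Xprev x)"
  define W3 where "W3 = (\<lambda>x. 2 *\<^sub>R Xnext x - 2 *\<^sub>R Xcur x)"
  define W4 where "W4 = (\<lambda>x. 3 *\<^sub>R Xnext x - 4 *\<^sub>R Xcur x + Xprev x)"
  define Z1 where "Z1 = (\<lambda>y. (3/8) *\<^sub>R Xprev y + (3/4) *\<^sub>R Xcur y - (1/8) *\<^sub>R Xnext y)"
  define Z3 where "Z3 = (\<lambda>y. - (1/8) *\<^sub>R Xprev y + (3/4) *\<^sub>R Xcur y + (3/8) *\<^sub>R Xnext y)"
  define h where "h j x = 1 / 90 * (7 * (W0 x \<bullet> area_vector q Xprev j) + 32 * (W1 x \<bullet> area_vector q Z1 j)
     + 12 * (W2 x \<bullet> area_vector q Xcur j) + 32 * (W3 x \<bullet> area_vector q Z3 j)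
     + 7 * (W4 x \<bullet> area_vector q Xnext j))" for j x
  note comb = P1_lincomb[OF assms(2-4)]
  have "W0 = (\<lambda>x. (- 3) *\<^sub>R Xprev x + 4 *\<^sub>R Xcur x + (- 1) *\<^sub>R Xnext x)"
    "W1 = (\<lambda>x. (- 2) *\<^sub>R Xprev x + 2 *\<^sub>R Xcur x + 0 *\<^sub>R Xnext x)"
    "W2 = (\<lambda>x. (- 1) *\<^sub>R Xprev x + 0 *\<^sub>R Xcur x + 1 *\<^sub>R Xnext x)"
    "W3 = (\<lambda>x. 0 *\<^sub>R Xprev x + (- 2) *\<^sub>R Xcur x + 2 *\<^sub>R Xnext x)"
    "W4 = (\<lambda>x. 1 *\<^sub>R Xprev x + (- 4) *\<^sub>R Xcur x + 3 *\<^sub>R Xnext x)"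
    by (simp_all add: W0_def W1_def W2_def W3_def W4_def fun_eq_iff vec_eq_iff)
  then have W: "W0 \<in> P1_space3 J q" "W1 \<in> P1_space3 J q" "W2 \<in> P1_space3 J q"
      "W3 \<in> P1_space3 J q" "W4 \<in> P1_space3 J q"
    by (simp_all only: comb)
  have "continuous_on (tri q j) (h j)" if "j \<in> {1..J}" for j
  proof -
    have "tri q j \<subseteq> mesh_surface J q" using that by (auto simp: mesh_surface_def)
    note contW = W[THEN P1_continuous, THEN continuous_on_subset, OF this]
    show ?thesis unfolding h_def by (intro continuous_intros contW)
  qed
  moreover have "h j (ref_map q j (s, t)) =
        h j (q j 1) + s * (h j (q j 2) - h j (q j 1)) + t * (h j (q j 3) - h j (q j 1))"
    if "j \<in> {1..J}" "(s, t) \<in> ref_triangle" for j s t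
    unfolding h_def W[THEN P1_affine, OF that]
    by (simp add: inner_add_left inner_diff_left algebra_simps)
  ultimately have "(LINT x:mesh_surface J q|dA0 J q. h (tri_index J q x) x) =
      1 / 6 * (\<Sum>j = 1..J. h j (q j 1) + h j (q j 2) + h j (q j 3))"
    by (rule integral_piecewise_affine[OF assms(1)])
  also have "\<dots> = 1 / 6 * (\<Sum>j = 1..J. 1 / 90 *
      (7 * ((W0 (q j 1) + W0 (q j 2) + W0 (q j 3)) \<bullet> area_vector q Xprev j)
     + 32 * ((W1 (q j 1) + W1 (q j 2) + W1 (q j 3)) \<bullet> area_vector q Z1 j)
     + 12 * ((W2 (q j 1) + W2 (q j 2) + W2 (q j 3)) \<bullet> area_vector q Xcur j)
     + 32 * ((W3 (q j 1) + W3 (q j 2) + W3 (q j 3)) \<bullet> area_vector q Z3 j)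
     + 7 * ((W4 (q j 1) + W4 (q j 2) + W4 (q j 3)) \<bullet> area_vector q Xnext j)))"
    unfolding h_def by (simp add: inner_add_left algebra_simps)
  also have "\<dots> = 1 / 540 * (7 * flux J q W0 Xprev + 32 * flux J q W1 Z1 + 12 * flux J q W2 Xcur
      + 32 * flux J q W3 Z3 + 7 * flux J q W4 Xnext)"
    unfolding flux_def by (simp only: sum.distrib flip: sum_distrib_left)
  also have "7 * flux J q W0 Xprev + 32 * flux J q W1 Z1 + 12 * flux J q W2 Xcur
      + 32 * flux J q W3 Z3 + 7 * flux J q W4 Xnext =
      (\<Sum>j = 1..J. 90 * (triple (Xnext (q j 1)) (Xnext (q j 2)) (Xnext (q j 3))
        - triple (Xprev (q j 1)) (Xprev (q j 2)) (Xprev (q j 3))))"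
    unfolding flux_eq[OF assms(1)] W0_def W1_def W2_def W3_def W4_def Z1_def Z3_def
      sum_distrib_left sum.distrib[symmetric]
    by (intro sum.cong refl boole_triple[symmetric])
  also have "1 / 540 * \<dots> = enclosed_volume J q Xnext - enclosed_volume J q Xprev"
    unfolding enclosed_volume_eq by (simp add: sum_subtractf flip: sum_distrib_left)
  finally show ?thesis
    unfolding h_def W0_def W1_def W2_def W3_def W4_def Z1_def Z3_def area_field_def tri_index_def
    by (rule sym)
qed

end
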